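(* Let $s\geq 1$ be real and let $A_s$ be the infinite matrix with entries $(A_s)_{ij}=\frac{1}{\max(i,j)+s}$, $i,j\in\{0,1,2,\dots\}$. Then for every real $p$ with $1<p<\infty$, $$\|A_s\|_{\ell^p\to\ell^p}=\frac{p^2}{p-1}.$$
   Context: Matrix and sequence indices start from $0$. The matrix $A_s$ is the $L$-matrix $[1/(n+s)]$, where for a sequence $(a_n)_{n\ge0}$ the $L$-matrix $[a_n]$ is the infinite matrix whose $(i,j)$ entry is $a_{\max(i,j)}$, $i,j\ge0$. It acts on sequences $x=(x_j)_{j\ge0}$ by $(A_sx)_i=\sum_{j\ge0}(A_s)_{ij}x_j$, and $\|A_s\|_{\ell^p\to\ell^p}:=\sup_{x\neq0}\frac{\|A_sx\|_p}{\|x\|_p}$, the supremum being over nonzero $x\in\ell^p$ (sequences indexed by $\{0,1,2,\dots\}$). *)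

theory Defs
  imports "HOL-Analysis.Analysis"
begin

text \<open>
  The scalars form an arbitrary complete real normed field \<open>'a\<close>, so that real and complex
  sequences are covered simultaneously.
\<close>

definition ell :: "real \<Rightarrow> (nat \<Rightarrow> 'a::real_normed_vector) set"
  where "ell p = {x. summable (\<lambda>n. norm (x n) powr p)}"

text \<open>The norm of a sequence outside \<open>ell p\<close> is infinite.\<close>

definition ell_norm :: "real \<Rightarrow> (nat \<Rightarrow> 'a::real_normed_vector) \<Rightarrow> ereal"
  where "ell_norm p x =
    (if x \<in> ell p then ereal ((\<Sum>n. norm (x n) powr p) powr (1 / p)) else \<infinity>)"

definition mat_apply :: "(nat \<Rightarrow> nat \<Rightarrow> 'a::real_normed_field) \<Rightarrow> (nat \<Rightarrow> 'a) \<Rightarrow> nat \<Rightarrow> 'a"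
  where "mat_apply A x i = (\<Sum>j. A i j * x j)"

text \<open>
  \<open>suminf\<close> has an unspecified value on divergent series. If some series defining \<open>A x\<close>
  diverges for a nonzero \<open>x\<close> in \<open>ell p\<close>, the norm is therefore set to infinity. Hence a finite
  value says in particular that \<open>A\<close> is a well-defined map from \<open>ell p\<close> into \<open>ell p\<close>.
\<close>

definition ell_opnorm :: "real \<Rightarrow> (nat \<Rightarrow> nat \<Rightarrow> 'a::real_normed_field) \<Rightarrow> ereal"
  where "ell_opnorm p A =
    (SUP x \<in> ell p - {\<lambda>_. 0}.
       if \<forall>i. summable (\<lambda>j. A i j * x j)
       then ell_norm p (mat_apply A x) / ell_norm p x else \<infinity>)"

definition L_matrix :: "(nat \<Rightarrow> 'a) \<Rightarrow> nat \<Rightarrow> nat \<Rightarrow> 'a"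
  where "L_matrix a i j = a (max i j)"

definition A_matrix :: "real \<Rightarrow> nat \<Rightarrow> nat \<Rightarrow> 'a::real_normed_field"
  where "A_matrix s = L_matrix (\<lambda>n. of_real (1 / (real n + s)))"

end

theory Submission
  imports Defs
begin

text \<open>
  Let \<open>q\<close> be the exponent conjugate to \<open>p\<close>, so that \<open>p\<^sup>2 / (p - 1) = p + q\<close>. On the power sequence
  \<open>x\<^sub>j = (j + s) powr - a\<close> with \<open>0 < a < 1\<close> the matrix acts almost as a scalar: the entries with
  \<open>j \<le> i\<close> average \<open>x\<close> and contribute about \<open>(i + s) powr - a / (1 - a)\<close>, and the entries with
  \<open>j > i\<close> contribute the tail \<open>\<Sum>j>i. (j + s) powr (- a - 1)\<close>, which is about
  \<open>(i + s) powr - a / a\<close>. The sum \<open>1 / (1 - a) + 1 / a\<close> of the two factors is \<open>p + q\<close> for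
  \<open>a = 1 / p\<close>, the exponent at which \<open>x\<close> just fails to lie in \<open>ell p\<close>, and also for \<open>a = 1 / q\<close>.
  Both halves of the proof exploit this.

  For the upper bound the entries may be enlarged to those of \<open>s = 1\<close>. Then the
  factor \<open>1 / (1 - a) + 1 / a\<close> bounds the action on \<open>(j + 1) powr - a\<close> exactly, without an error term
  (lemma \<open>A_matrix_weight_sum_le\<close>). The Schur test \<open>schur_test\<close> with the weight
  \<open>(j + 1) powr - (1 / p)\<close> needs precisely this bound for \<open>a = 1 / p\<close> on the rows and for
  \<open>a = 1 / q\<close> on the columns, and gives the norm bound \<open>p + q\<close>.

  For the lower bound take \<open>a = 1 / p + e\<close> with small \<open>e > 0\<close>, which puts \<open>x\<close> into \<open>ell p\<close>. Given
  \<open>C < p + q\<close>, lemma \<open>A_matrix_factor_uniform\<close> provides \<open>(A x)\<^sub>i \<ge> C x\<^sub>i\<close> for all \<open>i \<ge> N\<close>, with the same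
  \<open>N\<close> for all small \<open>e\<close>. The first \<open>N\<close> entries contribute at most \<open>N\<close> to \<open>\<Sum>i. x\<^sub>i powr p\<close>, while the
  whole sum tends to infinity as \<open>e\<close> tends to \<open>0\<close>. So the loss in the first \<open>N\<close> entries is
  negligible and the norm cannot be smaller than \<open>C\<close>.
\<close>

section \<open>Sums of powers\<close>

text \<open>
  The quotient is the mean value over \<open>[u, u + 1]\<close> of the decreasing function
  \<open>t powr (c - 1)\<close>. Writing the integral as a difference of powers makes sums telescope, and
  allowing both signs of \<open>c\<close> covers the divergent sums (\<open>c > 0\<close>) and the tails of convergent ones
  (\<open>c < 0\<close>) at once.
\<close>

lemma powr_diff_quotient_bounds:
  fixes u c :: real
  assumes "u > 0" "c \<le> 1" "c \<noteq> 0"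
  shows "(u + 1) powr (c - 1) \<le> ((u + 1) powr c - u powr c) / c"
    and "((u + 1) powr c - u powr c) / c \<le> u powr (c - 1)"
proof -
  have "\<exists>z. z > u \<and> z < u + 1 \<and> (u+1) powr c - u powr c = ((u+1) - u) * (c * z powr (c - 1))"
    using assms by (intro MVT2 has_real_derivative_powr) auto
  then obtain z where z: "u < z" "z < u + 1" "(u+1) powr c - u powr c = c * z powr (c - 1)"
    by auto
  have q: "((u + 1) powr c - u powr c) / c = z powr (c - 1)"
    using z(3) assms by simp
  show "(u + 1) powr (c - 1) \<le> ((u + 1) powr c - u powr c) / c"
    unfolding q using z assms by (intro powr_mono2') auto
  show "((u + 1) powr c - u powr c) / c \<le> u powr (c - 1)"
    unfolding q using z assms by (intro powr_mono2') auto
qed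

lemma sum_powr_lower_bound:
  fixes u c :: real
  assumes "u > 0" "c \<le> 1" "c \<noteq> 0"
  shows "((u + real n) powr c - u powr c) / c \<le> (\<Sum>k<n. (u + real k) powr (c - 1))"
proof (induction n)
  case (Suc n)
  show ?case
    using Suc powr_diff_quotient_bounds(2)[of "u + real n" c] assms
    by (simp add: add_ac diff_divide_distrib)
qed simp

lemma sum_powr_upper_bound:
  fixes u c :: real
  assumes "u > 0 \<or> u = 0 \<and> c > 0" "c \<le> 1" "c \<noteq> 0"
  shows "(\<Sum>k<n. (u + real k + 1) powr (c - 1)) \<le> ((u + real n) powr c - u powr c) / c"
proof (induction n)
  case (Suc n)
  have "(u + real n + 1) powr (c - 1) \<le> ((u + real n + 1) powr c - (u + real n) powr c) / c"
    \<comment> \<open>The mean value argument fails at \<open>0\<close>, where \<open>0 powr (c - 1) = 0\<close>; but there the claim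
      is just \<open>1 \<le> 1 / c\<close>.\<close>
  proof (cases "u + real n = 0")
    case True
    then have "u = 0" "n = 0" using assms by (auto simp: add_nonneg_eq_0_iff)
    then show ?thesis using assms by (auto simp: divide_simps)
  next
    case False
    then show ?thesis using assms by (intro powr_diff_quotient_bounds(1)) auto
  qed
  then show ?case using Suc by (simp add: add_ac diff_divide_distrib)
qed simp

section \<open>The upper bound\<close>

lemma sum_lessThan_add_split:
  fixes f :: "nat \<Rightarrow> real"
  shows "(\<Sum>j<m + n. f j) = (\<Sum>j<m. f j) + (\<Sum>k<n. f (m + k))"
  by (induction n) auto

text \<open>
  Shifting by \<open>1\<close> instead of \<open>s\<close> is what makes the constant exact: the comparison of the first
  \<open>i + 1\<close> summands with an integral then starts at \<open>0\<close>, where the antiderivative vanishes.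
\<close>

lemma A_matrix_weight_sum_le:
  fixes a s :: real
  assumes "s \<ge> 1" "0 < a" "a < 1"
  shows "(\<Sum>j<n. (real j + 1) powr - a / (real (max i j) + s))
    \<le> (1 / (1 - a) + 1 / a) * (real i + 1) powr - a"
proof -
  define f where "f j = (real j + 1) powr - a / (real (max i j) + 1)" for j
  have "(\<Sum>j<n. (real j + 1) powr - a / (real (max i j) + s)) \<le> (\<Sum>j<n. f j)"
    unfolding f_def using assms by (intro sum_mono divide_left_mono) auto
  also have "\<dots> \<le> (\<Sum>j<Suc i + n. f j)"
    by (intro sum_mono2) (auto simp: f_def)
  also have "\<dots> = (\<Sum>j<Suc i. f j) + (\<Sum>k<n. f (Suc i + k))"
    by (rule sum_lessThan_add_split)
  also have "\<dots> \<le> (real i + 1) powr - a / (1 - a) + (real i + 1) powr - a / a"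
  proof (rule add_mono)
    have "(\<Sum>j<Suc i. f j) = (\<Sum>j<Suc i. (0 + real j + 1) powr (1 - a - 1)) / (real i + 1)"
      unfolding f_def sum_divide_distrib by (intro sum.cong) (auto simp: max_def)
    also have "\<dots> \<le> ((0 + real (Suc i)) powr (1 - a) - 0 powr (1 - a)) / (1 - a) / (real i + 1)"
      using assms by (intro divide_right_mono sum_powr_upper_bound) auto
    also have "\<dots> = (real i + 1) powr - a / (1 - a)"
    proof -
      have "(real i + 1) powr (1 - a) = (real i + 1) * (real i + 1) powr - a"
        by (simp add: powr_diff powr_minus field_simps)
      then show ?thesis by (simp add: add.commute)
    qed
    finally show "(\<Sum>j<Suc i. f j) \<le> (real i + 1) powr - a / (1 - a)" .
  next
    have "(\<Sum>k<n. f (Suc i + k)) = (\<Sum>k<n. ((real i + 1) + real k + 1) powr (- a - 1))"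
      unfolding f_def
      by (intro sum.cong) (auto simp: max_def powr_diff add_ac)
    also have "\<dots> \<le> (((real i + 1) + real n) powr - a - (real i + 1) powr - a) / - a"
      using assms by (intro sum_powr_upper_bound) auto
    also have "\<dots> \<le> (real i + 1) powr - a / a"
      using assms by (simp add: divide_simps)
    finally show "(\<Sum>k<n. f (Suc i + k)) \<le> (real i + 1) powr - a / a" .
  qed
  finally show ?thesis by (simp add: field_simps)
qed

text \<open>
  Jensen's inequality for \<open>t powr p\<close> with weights that need not add up to \<open>1\<close>. Convexity
  is applied on the open half-line, so the vanishing summands are discarded first; this can only
  decrease the total weight.
\<close>

lemma powr_weighted_sum_le:
  fixes c t :: "'b \<Rightarrow> real"
  assumes "finite S" "p \<ge> 1" "\<And>j. j \<in> S \<Longrightarrow> c j \<ge> 0" "\<And>j. j \<in> S \<Longrightarrow> t j \<ge> 0"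
  shows "(\<Sum>j\<in>S. c j * t j) powr p \<le> (\<Sum>j\<in>S. c j) powr (p - 1) * (\<Sum>j\<in>S. c j * t j powr p)"
proof -
  define T where "T = {j \<in> S. c j * t j > 0}"
  define C where "C = (\<Sum>j\<in>T. c j)"
  have T: "finite T" "\<And>j. j \<in> T \<Longrightarrow> c j > 0" "\<And>j. j \<in> T \<Longrightarrow> t j > 0"
    using assms by (force simp: T_def zero_less_mult_iff)+
  have off: "c j * t j = 0" if "j \<in> S - T" for j
    using that assms(3,4)[of j] by (auto simp: T_def zero_less_mult_iff order_le_less)
  have 1: "(\<Sum>j\<in>S. c j * t j) = (\<Sum>j\<in>T. c j * t j)"
    using assms(1) off by (intro sum.mono_neutral_right) (auto simp: T_def)
  have 2: "(\<Sum>j\<in>S. c j * t j powr p) = (\<Sum>j\<in>T. c j * t j powr p)"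
    using assms(1) off by (intro sum.mono_neutral_right) (auto simp: T_def)
  show ?thesis
  proof (cases "T = {}")
    case True
    then show ?thesis unfolding 1 2 by simp
  next
    case False
    have C: "C > 0" unfolding C_def using T False by (intro sum_pos) auto
    have CS: "C \<le> (\<Sum>j\<in>S. c j)"
      unfolding C_def using assms by (intro sum_mono2) (auto simp: T_def)
    have one: "(\<Sum>j\<in>T. c j / C) = 1"
      using C by (simp add: C_def flip: sum_divide_distrib)
    have "(\<Sum>j\<in>T. (c j / C) *\<^sub>R t j) powr p \<le> (\<Sum>j\<in>T. (c j / C) * t j powr p)"
      using assms C False T one
      by (intro convex_on_sum[OF _ _ powr_convex[of p]]) (auto intro: less_imp_le)
    also have "(\<Sum>j\<in>T. (c j / C) *\<^sub>R t j) = (\<Sum>j\<in>T. c j * t j) / C"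
      by (simp add: sum_divide_distrib)
    also have "(\<Sum>j\<in>T. (c j / C) * t j powr p) = (\<Sum>j\<in>T. c j * t j powr p) / C"
      by (simp add: sum_divide_distrib)
    finally have "((\<Sum>j\<in>T. c j * t j) / C) powr p \<le> (\<Sum>j\<in>T. c j * t j powr p) / C" .
    moreover have "(\<Sum>j\<in>T. c j * t j) \<ge> 0" using T by (intro sum_nonneg) (auto intro: less_imp_le)
    ultimately have "(\<Sum>j\<in>T. c j * t j) powr p \<le> C powr (p - 1) * (\<Sum>j\<in>T. c j * t j powr p)"
      using C by (simp add: powr_divide powr_diff field_simps)
    also have "\<dots> \<le> (\<Sum>j\<in>S. c j) powr (p - 1) * (\<Sum>j\<in>T. c j * t j powr p)"
      using assms C CS T by (intro mult_right_mono powr_mono2 sum_nonneg mult_nonneg_nonneg)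
        (auto intro: less_imp_le)
    finally show ?thesis unfolding 1 2 .
  qed
qed

text \<open>
  Each row is split as \<open>K i j * y j = (K i j * w j) * (y j / w j)\<close>, and Jensen's inequality with
  weights \<open>K i j * w j\<close> reduces the claim to the row condition, after which exchanging the two
  sums brings in the column condition. The column weight \<open>w powr (p - 1)\<close> is the one for which
  all powers of \<open>w\<close> cancel in the end. Finite sections suffice, as the bound does not depend on
  their size.
\<close>

lemma schur_test_finite:
  fixes K :: "nat \<Rightarrow> nat \<Rightarrow> real" and w y :: "nat \<Rightarrow> real"
  assumes p: "p > 1" and M: "M > 0"
    and K: "\<And>i j. K i j \<ge> 0" and w: "\<And>j. w j > 0" and y: "\<And>j. y j \<ge> 0"
    and row: "\<And>i n. (\<Sum>j<n. K i j * w j) \<le> M * w i"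
    and col: "\<And>j n. (\<Sum>i<n. K i j * w i powr (p - 1)) \<le> M * w j powr (p - 1)"
  shows "(\<Sum>i<m. (\<Sum>j<n. K i j * y j) powr p) \<le> M powr p * (\<Sum>j<n. y j powr p)"
proof -
  define r where "r j = (y j / w j) powr p * w j" for j
  have r: "r j \<ge> 0" for j using w[of j] by (simp add: r_def)
  have "(\<Sum>j<n. K i j * y j) powr p
      \<le> M powr (p - 1) * (\<Sum>j<n. w i powr (p - 1) * (K i j * r j))" for i
  proof -
    have "(\<Sum>j<n. K i j * y j) = (\<Sum>j<n. (K i j * w j) * (y j / w j))"
      using w by (intro sum.cong) (auto simp: less_imp_neq[THEN not_sym])
    also have "\<dots> powr p \<le> (\<Sum>j<n. K i j * w j) powr (p - 1)
        * (\<Sum>j<n. (K i j * w j) * (y j / w j) powr p)"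
      using p K w y by (intro powr_weighted_sum_le) (auto simp: less_imp_le)
    also have "\<dots> \<le> (M * w i) powr (p - 1) * (\<Sum>j<n. (K i j * w j) * (y j / w j) powr p)"
      using p K w y
      by (intro mult_right_mono powr_mono2 row sum_nonneg) (auto simp: less_imp_le)
    also have "\<dots> = M powr (p - 1) * (\<Sum>j<n. w i powr (p - 1) * (K i j * r j))"
      using M w[of i] by (simp add: powr_mult r_def sum_distrib_left mult_ac)
    finally show ?thesis .
  qed
  then have "(\<Sum>i<m. (\<Sum>j<n. K i j * y j) powr p)
      \<le> (\<Sum>i<m. M powr (p - 1) * (\<Sum>j<n. w i powr (p - 1) * (K i j * r j)))"
    by (rule sum_mono)
  also have "\<dots> = M powr (p - 1) * (\<Sum>j<n. r j * (\<Sum>i<m. K i j * w i powr (p - 1)))"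
  proof -
    have "(\<Sum>i<m. \<Sum>j<n. w i powr (p - 1) * (K i j * r j))
        = (\<Sum>j<n. \<Sum>i<m. r j * (K i j * w i powr (p - 1)))"
      by (subst sum.swap) (simp add: mult_ac)
    then show ?thesis unfolding sum_distrib_left[symmetric] by simp
  qed
  also have "\<dots> \<le> M powr (p - 1) * (\<Sum>j<n. r j * (M * w j powr (p - 1)))"
    using r by (intro mult_left_mono sum_mono col) auto
  also have "\<dots> = M powr (p - 1) * (\<Sum>j<n. M * y j powr p)"
  proof -
    have "r j * (M * w j powr (p - 1)) = M * y j powr p" for j
      using w[of j] y[of j] by (simp add: r_def powr_divide powr_diff)
    then show ?thesis by (simp only:)
  qed
  also have "\<dots> = M powr p * (\<Sum>j<n. y j powr p)"
    using M by (simp add: sum_distrib_left[symmetric] powr_diff)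
  finally show ?thesis .
qed

text \<open>
  Passing to infinite sections needs two limits: the rows converge absolutely because their
  partial sums are bounded by the finite test, and then the number of rows may grow.
\<close>

lemma schur_test:
  fixes A :: "nat \<Rightarrow> nat \<Rightarrow> 'a::{real_normed_field,banach}" and w :: "nat \<Rightarrow> real"
  assumes p: "p > 1" and M: "M > 0" and w: "\<And>j. w j > 0"
    and row: "\<And>i n. (\<Sum>j<n. norm (A i j) * w j) \<le> M * w i"
    and col: "\<And>j n. (\<Sum>i<n. norm (A i j) * w i powr (p - 1)) \<le> M * w j powr (p - 1)"
  shows "ell_opnorm p A \<le> ereal M"
  unfolding ell_opnorm_def
proof (rule SUP_least)
  fix x :: "nat \<Rightarrow> 'a" assume x: "x \<in> ell p - {\<lambda>_. 0}"
  define y where "y = (\<lambda>j. norm (x j))"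
  define S where "S = (\<Sum>j. y j powr p)"
  have sy: "summable (\<lambda>j. y j powr p)" using x by (simp add: ell_def y_def)
  obtain k where "x k \<noteq> 0" using x by auto
  then have "y k powr p > 0" by (simp add: y_def)
  then have S: "S > 0" unfolding S_def using sy by (intro suminf_pos2[of _ k]) auto
  have fin: "(\<Sum>i<m. (\<Sum>j<n. norm (A i j) * y j) powr p) \<le> M powr p * S" for m n
  proof -
    have "(\<Sum>i<m. (\<Sum>j<n. norm (A i j) * y j) powr p) \<le> M powr p * (\<Sum>j<n. y j powr p)"
      using p M w row col by (intro schur_test_finite[where w = w]) (auto simp: y_def)
    also have "\<dots> \<le> M powr p * S"
      unfolding S_def using sy by (intro mult_left_mono sum_le_suminf) auto
    finally show ?thesis .
  qed
  have sumrow: "summable (\<lambda>j. norm (A i j) * y j)" for i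
  proof (rule summableI_nonneg_bounded)
    show "0 \<le> norm (A i j) * y j" for j by (simp add: y_def)
    fix n
    have "(\<Sum>j<n. norm (A i j) * y j) powr p \<le> (\<Sum>k<Suc i. (\<Sum>j<n. norm (A k j) * y j) powr p)"
      by (intro member_le_sum[of i "{..<Suc i}" "\<lambda>k. (\<Sum>j<n. norm (A k j) * y j) powr p"]) auto
    also have "\<dots> \<le> M powr p * S" by (rule fin)
    finally have "((\<Sum>j<n. norm (A i j) * y j) powr p) powr (1/p) \<le> (M powr p * S) powr (1/p)"
      using p by (intro powr_mono2) auto
    then show "(\<Sum>j<n. norm (A i j) * y j) \<le> (M powr p * S) powr (1/p)"
      using p by (simp add: powr_powr sum_nonneg y_def)
  qed
  have fin2: "(\<Sum>i<m. (\<Sum>j. norm (A i j) * y j) powr p) \<le> M powr p * S" for m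
  proof (rule LIMSEQ_le_const2)
    show "(\<lambda>n. \<Sum>i<m. (\<Sum>j<n. norm (A i j) * y j) powr p)
        \<longlonglongrightarrow> (\<Sum>i<m. (\<Sum>j. norm (A i j) * y j) powr p)"
      using p by (intro tendsto_sum tendsto_powr2 summable_LIMSEQ sumrow tendsto_const)
        (auto intro!: always_eventually sum_nonneg simp: y_def)
  qed (use fin in auto)
  have sx: "summable (\<lambda>j. norm (A i j * x j))" for i
    using sumrow[of i] by (simp add: norm_mult y_def)
  have le: "norm (mat_apply A x i) \<le> (\<Sum>j. norm (A i j) * y j)" for i
    using summable_norm[OF sx[of i]] by (simp add: mat_apply_def norm_mult y_def)
  have fin3: "(\<Sum>i<m. norm (mat_apply A x i) powr p) \<le> M powr p * S" for m
    by (rule order_trans[OF _ fin2[of m]]) (use p le in \<open>auto intro!: sum_mono powr_mono2\<close>)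
  have sA: "summable (\<lambda>i. norm (mat_apply A x i) powr p)"
    by (rule summableI_nonneg_bounded[OF _ fin3]) auto
  have "(\<Sum>i. norm (mat_apply A x i) powr p) \<le> M powr p * S"
    by (rule suminf_le_const[OF sA fin3])
  then have "(\<Sum>i. norm (mat_apply A x i) powr p) powr (1/p) \<le> (M powr p * S) powr (1/p)"
    using p sA by (intro powr_mono2 suminf_nonneg) auto
  also have "\<dots> = M * S powr (1/p)"
    using p M S by (simp add: powr_mult powr_powr)
  finally have "(\<Sum>i. norm (mat_apply A x i) powr p) powr (1/p) / S powr (1/p) \<le> M"
    using S by (simp add: pos_divide_le_eq)
  moreover have "ell_norm p (mat_apply A x) = ereal ((\<Sum>i. norm (mat_apply A x i) powr p) powr (1/p))"
    using sA by (simp add: ell_norm_def ell_def)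
  moreover have "ell_norm p x = ereal (S powr (1/p))"
    using x by (simp add: ell_norm_def S_def y_def)
  moreover have "S powr (1/p) \<noteq> 0" using S by simp
  ultimately have "ell_norm p (mat_apply A x) / ell_norm p x \<le> ereal M"
    by simp
  moreover have "\<forall>i. summable (\<lambda>j. A i j * x j)"
    using summable_norm_cancel[OF sx] ..
  ultimately show "(if \<forall>i. summable (\<lambda>j. A i j * x j)
      then ell_norm p (mat_apply A x) / ell_norm p x else \<infinity>) \<le> ereal M"
    by simp
qed

lemma norm_A_matrix:
  assumes "s \<ge> 1"
  shows "norm (A_matrix s i j :: 'a::real_normed_field) = 1 / (real (max i j) + s)"
  using assms unfolding A_matrix_def L_matrix_def norm_of_real by simp

theorem ell_opnorm_A_matrix_le:
  fixes s p :: real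
  assumes s: "s \<ge> 1" and p: "1 < p"
  shows "ell_opnorm p (A_matrix s :: nat \<Rightarrow> nat \<Rightarrow> 'a::{real_normed_field,banach})
    \<le> ereal (p\<^sup>2 / (p - 1))"
proof (rule schur_test[where w = "\<lambda>j. (real j + 1) powr - (1 / p)"])
  \<comment> \<open>The row condition uses the exponent \<open>1 / p\<close>, the column condition its conjugate; the
    constant is symmetric under exchanging them.\<close>
  have M: "1 / (1 - 1/p) + 1 / (1/p) = p\<^sup>2 / (p - 1)"
    "1 / (1 - (1 - 1/p)) + 1 / (1 - 1/p) = p\<^sup>2 / (p - 1)"
    using p by (auto simp: field_simps power2_eq_square)
  show "(\<Sum>j<n. norm (A_matrix s i j :: 'a) * (real j + 1) powr - (1 / p))
      \<le> p\<^sup>2 / (p - 1) * (real i + 1) powr - (1 / p)" for i n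
    using A_matrix_weight_sum_le[of s "1/p" i n] s p unfolding M
    by (simp add: norm_A_matrix)
  have e: "((real j + 1) powr - (1 / p)) powr (p - 1) = (real j + 1) powr - (1 - 1 / p)" for j
    using p by (simp add: powr_powr field_simps)
  show "(\<Sum>i<n. norm (A_matrix s i j :: 'a) * ((real i + 1) powr - (1 / p)) powr (p - 1))
      \<le> p\<^sup>2 / (p - 1) * ((real j + 1) powr - (1 / p)) powr (p - 1)" for j n
    using A_matrix_weight_sum_le[of s "1 - 1/p" j n] s p unfolding M e
    by (simp add: norm_A_matrix max.commute)
qed (use p in auto)


section \<open>Power sequences as almost extremal sequences\<close>

lemma summable_shifted_powr:
  fixes s b :: real
  assumes "s > 0" "b > 0"
  shows "summable (\<lambda>n. (s + real n) powr (- b - 1))"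
proof -
  have "(\<Sum>k<n. (s + real k + 1) powr (- b - 1)) \<le> s powr - b / b" for n
  proof -
    have "(\<Sum>k<n. (s + real k + 1) powr (- b - 1)) \<le> ((s + real n) powr - b - s powr - b) / - b"
      using assms by (intro sum_powr_upper_bound) auto
    also have "\<dots> \<le> s powr - b / b"
      using assms by (simp add: divide_simps)
    finally show ?thesis .
  qed
  then have "summable (\<lambda>k. (s + real k + 1) powr (- b - 1))"
    by (intro summableI_nonneg_bounded) auto
  then show ?thesis by (subst summable_Suc_iff[symmetric]) (simp add: add_ac)
qed

lemma tendsto_shifted_neg_powr:
  fixes u a :: real
  assumes "a > 0"
  shows "(\<lambda>n. (u + real n) powr - a) \<longlonglongrightarrow> 0"
  using assms
  by (intro tendsto_neg_powr filterlim_tendsto_add_at_top[OF tendsto_const] filterlim_real_sequentially) auto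

text \<open>
  This quantifies the divergence of the harmonic series: the sum blows up at least like \<open>1 / b\<close>
  as \<open>b\<close> tends to \<open>0\<close>.
\<close>

lemma suminf_shifted_powr_ge:
  fixes s b :: real
  assumes "s > 0" "b > 0"
  shows "s powr - b / b \<le> (\<Sum>n. (s + real n) powr (- b - 1))"
proof (rule LIMSEQ_le)
  show "(\<lambda>n. ((s + real n) powr - b - s powr - b) / - b) \<longlonglongrightarrow> s powr - b / b"
    using tendsto_divide[OF tendsto_diff[OF tendsto_shifted_neg_powr[OF assms(2), of s] tendsto_const] tendsto_const,
      of "- b" "s powr - b"] assms by simp
  show "(\<lambda>n. \<Sum>k<n. (s + real k) powr (- b - 1)) \<longlonglongrightarrow> (\<Sum>n. (s + real n) powr (- b - 1))"
    by (intro summable_LIMSEQ summable_shifted_powr assms)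
  show "\<exists>N. \<forall>n\<ge>N. ((s + real n) powr - b - s powr - b) / - b \<le> (\<Sum>k<n. (s + real k) powr (- b - 1))"
    using assms by (intro exI allI impI sum_powr_lower_bound) auto
qed

text \<open>
  A lower bound for the factor by which \<open>A_matrix s\<close> stretches the \<open>i\<close>-th entry of the power
  sequence with exponent \<open>- a\<close>. The first summand comes from the entries up to the diagonal, the
  second from those beyond it. The corrections to \<open>1 / (1 - a) + 1 / a\<close> vanish for large \<open>i\<close>.
\<close>

definition A_matrix_factor :: "real \<Rightarrow> real \<Rightarrow> nat \<Rightarrow> real"
  where "A_matrix_factor s a i = 1 / (1 - a) * (1 - (s / (real i + s)) powr (1 - a))
    + 1 / a * ((real i + s) / (real i + 1 + s)) powr a"

lemma A_matrix_power_sum_ge: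
  fixes a s :: real
  assumes s: "s > 0" and a: "0 < a" "a < 1"
    and summ: "summable (\<lambda>j. (real j + s) powr - a / (real (max i j) + s))"
  shows "A_matrix_factor s a i * (real i + s) powr - a
    \<le> (\<Sum>j. (real j + s) powr - a / (real (max i j) + s))"
proof (rule LIMSEQ_le_const2)
  define f where "f j = (real j + s) powr - a / (real (max i j) + s)" for j
  define v where "v = real i + s"
  have v: "v > 0" using s by (simp add: v_def add_nonneg_pos)
  \<comment> \<open>\<open>H\<close> is the integral bound for the part of the row up to the diagonal.\<close>
  define H where "H = (v powr (1 - a) - s powr (1 - a)) / (1 - a) / v"
  have "H = 1 / (1 - a) * (1 - (s / v) powr (1 - a)) * v powr - a"
    using v s a by (simp add: H_def powr_divide powr_diff powr_minus field_simps)
  moreover have "(v + 1) powr - a / a = 1 / a * (v / (v + 1)) powr a * v powr - a"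
    using v a by (simp add: powr_divide powr_minus field_simps)
  ultimately have eq: "A_matrix_factor s a i * (real i + s) powr - a = H + ((v + 1) powr - a - 0) / a"
    unfolding A_matrix_factor_def
    by (simp only: distrib_right diff_zero flip: v_def) (simp add: v_def add_ac)
  show "(\<lambda>n. H + ((v + 1) powr - a - (v + 1 + real n) powr - a) / a)
    \<longlonglongrightarrow> A_matrix_factor s a i * (real i + s) powr - a"
    unfolding eq using a
    by (intro tendsto_add[OF tendsto_const] tendsto_divide tendsto_diff tendsto_const
        tendsto_shifted_neg_powr) auto
  have "H + ((v + 1) powr - a - (v + 1 + real n) powr - a) / a \<le> suminf f" for n
  proof -
    have "H \<le> ((s + real (Suc i)) powr (1 - a) - s powr (1 - a)) / (1 - a) / v"
      unfolding H_def v_def using a s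
      by (intro divide_right_mono diff_right_mono powr_mono2) auto
    also have "\<dots> \<le> (\<Sum>j<Suc i. (s + real j) powr (1 - a - 1)) / v"
      using s a v by (intro divide_right_mono sum_powr_lower_bound) auto
    also have "\<dots> = (\<Sum>j<Suc i. f j)"
      unfolding f_def v_def sum_divide_distrib by (intro sum.cong) (auto simp: max_def add_ac)
    finally have head: "H \<le> (\<Sum>j<Suc i. f j)" .
    have "((v + 1) powr - a - (v + 1 + real n) powr - a) / a
        = ((v + 1 + real n) powr - a - (v + 1) powr - a) / - a"
      using a by (simp add: field_simps)
    also have "\<dots> \<le> (\<Sum>k<n. (v + 1 + real k) powr (- a - 1))"
      using a v by (intro sum_powr_lower_bound) auto
    also have "\<dots> = (\<Sum>k<n. f (Suc i + k))"
      unfolding f_def v_def using s by (intro sum.cong) (auto simp: max_def powr_diff add_ac)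
    finally have "H + ((v + 1) powr - a - (v + 1 + real n) powr - a) / a \<le> (\<Sum>j<Suc i + n. f j)"
      unfolding sum_lessThan_add_split using head by linarith
    also have "\<dots> \<le> suminf f"
      using summ s by (intro sum_le_suminf) (auto simp: f_def)
    finally show ?thesis .
  qed
  then show "\<exists>N. \<forall>n\<ge>N. H + ((v + 1) powr - a - (v + 1 + real n) powr - a) / a
      \<le> (\<Sum>j. (real j + s) powr - a / (real (max i j) + s))"
    unfolding f_def by auto
qed

text \<open>
  It is essential that \<open>N\<close> does not depend on \<open>e\<close>. This comes from taking the limit of the factor
  jointly in \<open>e\<close> and \<open>i\<close>, that is, along the product filter.
\<close>

lemma A_matrix_factor_uniform:
  fixes s p C :: real
  assumes s: "s > 0" and p: "1 < p" and C: "C < p\<^sup>2 / (p - 1)"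
  obtains N d where "d > 0"
    "\<And>e i. 0 < e \<Longrightarrow> e < d \<Longrightarrow> N \<le> i \<Longrightarrow> C < A_matrix_factor s (1 / p + e) i"
proof -
  define F :: "(real \<times> nat) filter" where "F = at_right 0 \<times>\<^sub>F sequentially"
  have e: "(fst \<longlongrightarrow> (0::real)) F"
    unfolding F_def by (rule filterlim_compose[OF tendsto_ident_at filterlim_fst])
  have i: "filterlim (\<lambda>z. real (snd z)) at_top F"
    unfolding F_def by (rule filterlim_compose[OF filterlim_real_sequentially filterlim_snd])
  have i': "filterlim (\<lambda>z. real (snd z) + c) at_top F" for c
    by (subst add.commute) (rule filterlim_tendsto_add_at_top[OF tendsto_const i])
  have r1: "((\<lambda>z. s / (real (snd z) + s)) \<longlongrightarrow> 0) F"
    by (intro tendsto_divide_0[OF tendsto_const] filterlim_at_top_imp_at_infinity i')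
  have "((\<lambda>z. 1 - 1 / (real (snd z) + (1 + s))) \<longlongrightarrow> 1 - 0) F"
    by (intro tendsto_intros tendsto_divide_0[OF tendsto_const] filterlim_at_top_imp_at_infinity i')
  moreover have "1 - 1 / (real n + (1 + s)) = (real n + s) / (real n + 1 + s)" for n
    using s by (simp add: field_simps)
  ultimately have r2: "((\<lambda>z. (real (snd z) + s) / (real (snd z) + 1 + s)) \<longlongrightarrow> 1) F"
    by simp
  have r1': "((\<lambda>z. (s / (real (snd z) + s)) powr (1 - (1/p + fst z))) \<longlongrightarrow> 0) F"
    using p s by (intro tendsto_zero_powrI[OF r1 tendsto_diff[OF tendsto_const tendsto_add[OF tendsto_const e]]]) auto
  have "((\<lambda>z. A_matrix_factor s (1/p + fst z) (snd z)) \<longlongrightarrow>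
      1 / (1 - (1/p + 0)) * (1 - 0) + 1 / (1/p + 0) * 1 powr (1/p + 0)) F"
    unfolding A_matrix_factor_def using p
    by (intro tendsto_intros e r1' r2) auto
  also have "1 / (1 - (1/p + 0)) * (1 - 0) + 1 / (1/p + 0) * 1 powr (1/p + 0) = p\<^sup>2 / (p - 1)"
    using p by (simp add: field_simps power2_eq_square)
  finally have "eventually (\<lambda>z. C < A_matrix_factor s (1/p + fst z) (snd z)) F"
    using C by (rule order_tendstoD)
  then obtain P Q where "eventually P (at_right (0::real))" "eventually Q sequentially"
    and PQ: "\<And>e i. P e \<Longrightarrow> Q i \<Longrightarrow> C < A_matrix_factor s (1/p + e) i"
    unfolding F_def eventually_prod_filter by auto
  then obtain d N where "d > 0" "\<And>e. 0 < e \<Longrightarrow> e < d \<Longrightarrow> P e" "\<And>i. N \<le> i \<Longrightarrow> Q i"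
    unfolding eventually_at_right_field eventually_sequentially by auto
  with PQ show ?thesis by (intro that[of d N]) auto
qed

section \<open>The lower bound\<close>

text \<open>
  A finite bound on the operator norm excludes the default value \<open>\<infinity>\<close> both for a divergent row and
  for an image outside \<open>ell p\<close>, so it yields convergence as well as the norm inequality.
\<close>

lemma ell_opnorm_leD:
  fixes A :: "nat \<Rightarrow> nat \<Rightarrow> 'a::real_normed_field"
  assumes le: "ell_opnorm p A \<le> ereal B" and p: "p > 0" and x: "x \<in> ell p" "x \<noteq> (\<lambda>_. 0)"
  shows "summable (\<lambda>j. A i j * x j)"
    and "summable (\<lambda>i. norm (mat_apply A x i) powr p)"
    and "(\<Sum>i. norm (mat_apply A x i) powr p) \<le> B powr p * (\<Sum>j. norm (x j) powr p)"
    and "B \<ge> 0"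
proof -
  define S where "S = (\<Sum>j. norm (x j) powr p)"
  obtain k where "x k \<noteq> 0" using x by auto
  then have S: "S > 0"
    unfolding S_def using x by (intro suminf_pos2[of _ k]) (auto simp: ell_def)
  have le': "(if \<forall>i. summable (\<lambda>j. A i j * x j)
      then ell_norm p (mat_apply A x) / ell_norm p x else \<infinity>) \<le> ereal B"
    using le x unfolding ell_opnorm_def SUP_le_iff by auto
  then have sm: "\<forall>i. summable (\<lambda>j. A i j * x j)" by (auto split: if_splits)
  then show "summable (\<lambda>j. A i j * x j)" by blast
  have q: "ell_norm p (mat_apply A x) / ell_norm p x \<le> ereal B" using le' sm by simp
  have nx: "ell_norm p x = ereal (S powr (1/p))" using x by (simp add: ell_norm_def S_def)
  have pos: "S powr (1/p) > 0" using S by simp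
  have mem: "mat_apply A x \<in> ell p"
    using q pos unfolding nx by (auto simp: ell_norm_def split: if_splits)
  then show sA: "summable (\<lambda>i. norm (mat_apply A x i) powr p)" by (simp add: ell_def)
  define T where "T = (\<Sum>i. norm (mat_apply A x i) powr p)"
  have T: "T \<ge> 0" unfolding T_def by (intro suminf_nonneg sA) auto
  have "T powr (1/p) / S powr (1/p) \<le> B"
    using q pos mem unfolding nx by (simp add: ell_norm_def T_def)
  then have TB: "T powr (1/p) \<le> B * S powr (1/p)" using pos by (simp add: divide_simps)
  then show B: "B \<ge> 0" using pos
    by (smt (verit) powr_ge_zero mult_neg_pos)
  have "(T powr (1/p)) powr p \<le> (B * S powr (1/p)) powr p"
    using TB p by (intro powr_mono2) auto
  then show "(\<Sum>i. norm (mat_apply A x i) powr p) \<le> B powr p * (\<Sum>j. norm (x j) powr p)"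
    using p T S B by (simp add: powr_powr powr_mult flip: S_def T_def)
qed

text \<open>
  The test sequence has exponent \<open>1 / p + e\<close>, so the \<open>p\<close>-th powers of its entries are
  \<open>(s + n) powr (- (p * e) - 1)\<close>. The entries with index below \<open>N\<close> are given up; as every entry is at
  most \<open>1\<close>, this costs at most \<open>N\<close>.
\<close>

lemma A_matrix_power_sequence_bound:
  fixes s p B C e :: real
  assumes s: "s \<ge> 1" and p: "1 < p" and e: "0 < e" "1 / p + e < 1" and C: "C \<ge> 0"
    and le: "ell_opnorm p (A_matrix s :: nat \<Rightarrow> nat \<Rightarrow> 'a::{real_normed_field,banach}) \<le> ereal B"
    and fac: "\<And>i. N \<le> i \<Longrightarrow> C \<le> A_matrix_factor s (1 / p + e) i"
  shows "B \<ge> 0"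
    and "C powr p * ((\<Sum>n. (s + real n) powr (- (p * e) - 1)) - real N)
      \<le> B powr p * (\<Sum>n. (s + real n) powr (- (p * e) - 1))"
proof -
  let ?A = "A_matrix s :: nat \<Rightarrow> nat \<Rightarrow> 'a"
  define a where "a = 1 / p + e"
  define g where "g n = (s + real n) powr (- (p * e) - 1)" for n
  define x :: "nat \<Rightarrow> 'a" where "x n = of_real ((real n + s) powr - a)" for n
  define f where "f i j = (real j + s) powr - a / (real (max i j) + s)" for i j
  have a: "0 < a" "a < 1" using p e by (auto simp: a_def add_pos_pos)
  have pa: "p * a = 1 + p * e" using p by (simp add: a_def field_simps)
  have nx: "((real n + s) powr - a) powr p = g n" for n
  proof -
    have "- a * p = - (p * e) - 1" using pa by (simp add: algebra_simps)
    then show ?thesis by (simp add: g_def powr_powr add_ac)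
  qed
  have sg: "summable g"
    unfolding g_def using s p e by (intro summable_shifted_powr) auto
  have xell: "x \<in> ell p" using sg by (simp add: ell_def x_def nx)
  have "x 0 \<noteq> 0" using s by (simp add: x_def)
  then have x0: "x \<noteq> (\<lambda>_. 0)" by auto
  note bd = ell_opnorm_leD[OF le _ xell x0]
  show "B \<ge> 0" using bd(4) p by simp
  have entry: "?A i j * x j = of_real (f i j)" for i j
    by (simp add: A_matrix_def L_matrix_def x_def f_def)
  have sf: "summable (f i)" for i
  proof -
    have "summable (\<lambda>j. of_real (f i j) :: 'a)" using bd(1)[of i] p by (simp add: entry)
    \<comment> \<open>The scalars may be any normed field, and \<open>of_real\<close> is isometric; so the Cauchy
      criterion transfers.\<close>
    then show ?thesis
      unfolding summable_Cauchy by (simp flip: of_real_sum)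
  qed
  have app: "mat_apply ?A x i = of_real (suminf (f i))" for i
    unfolding mat_apply_def entry by (rule bounded_linear.suminf[OF bounded_linear_of_real sf, symmetric])
  have low: "C powr p * g i \<le> norm (mat_apply ?A x i) powr p" if "N \<le> i" for i
  proof -
    have "C * (real i + s) powr - a \<le> A_matrix_factor s a i * (real i + s) powr - a"
      using fac[OF that] by (intro mult_right_mono) (auto simp: a_def)
    also have "\<dots> \<le> suminf (f i)"
      unfolding f_def using s a sf[of i] by (intro A_matrix_power_sum_ge) (auto simp: f_def[abs_def])
    finally have "C * (real i + s) powr - a \<le> norm (mat_apply ?A x i)"
      by (simp add: app)
    then have "(C * (real i + s) powr - a) powr p \<le> norm (mat_apply ?A x i) powr p"
      using C p by (intro powr_mono2) auto
    then show ?thesis using C by (simp add: powr_mult nx)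
  qed
  have g1: "g n \<le> 1" for n
  proof -
    have "0 < p * e" using p e by simp
    then show ?thesis
      unfolding g_def using s powr_mono2'[of "- (p * e) - 1" 1 "s + real n"] by simp
  qed
  have "suminf g = (\<Sum>n. g (n + N)) + (\<Sum>n<N. g n)"
    by (rule suminf_split_initial_segment[OF sg])
  also have "(\<Sum>n<N. g n) \<le> (\<Sum>n<N. 1)" by (intro sum_mono g1)
  finally have "suminf g - real N \<le> (\<Sum>n. g (n + N))" by simp
  then have "C powr p * (suminf g - real N) \<le> C powr p * (\<Sum>n. g (n + N))"
    by (intro mult_left_mono) auto
  also have "\<dots> = (\<Sum>n. C powr p * g (n + N))"
    by (rule suminf_mult[symmetric]) (use sg in \<open>simp add: summable_iff_shift\<close>)
  also have "\<dots> \<le> (\<Sum>n. norm (mat_apply ?A x (n + N)) powr p)"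
    using low bd(2) sg p
    by (intro suminf_le summable_mult) (auto simp: summable_iff_shift[of g] summable_iff_shift[of "\<lambda>n. norm (mat_apply ?A x n) powr p"])
  also have "\<dots> \<le> (\<Sum>n. norm (mat_apply ?A x n) powr p)"
    using suminf_split_initial_segment[of "\<lambda>n. norm (mat_apply ?A x n) powr p" N] bd(2) p
    by (simp add: sum_nonneg)
  also have "\<dots> \<le> B powr p * suminf g"
    using bd(3) p by (simp add: x_def nx)
  finally show "C powr p * ((\<Sum>n. (s + real n) powr (- (p * e) - 1)) - real N)
      \<le> B powr p * (\<Sum>n. (s + real n) powr (- (p * e) - 1))"
    by (simp add: g_def[abs_def])
qed

text \<open>
  If the norm were at most \<open>B < C < p\<^sup>2 / (p - 1)\<close>, the preceding lemma would bound
  \<open>\<Sum>n. (s + n) powr (- (p * e) - 1)\<close> independently of \<open>e\<close>, although this sum tends to infinity.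
\<close>

lemma ell_opnorm_A_matrix_not_le:
  fixes s p B :: real
  assumes s: "s \<ge> 1" and p: "1 < p" and B: "B < p\<^sup>2 / (p - 1)"
  shows "\<not> ell_opnorm p (A_matrix s :: nat \<Rightarrow> nat \<Rightarrow> 'a::{real_normed_field,banach}) \<le> ereal B"
proof
  assume le: "ell_opnorm p (A_matrix s :: nat \<Rightarrow> nat \<Rightarrow> 'a) \<le> ereal B"
  have M: "p\<^sup>2 / (p - 1) > 0" using p by simp
  obtain C where C: "max B 0 < C" "C < p\<^sup>2 / (p - 1)"
    using dense[of "max B 0" "p\<^sup>2 / (p - 1)"] B M by auto
  obtain N d where d: "d > 0"
    and fac: "\<And>e i. 0 < e \<Longrightarrow> e < d \<Longrightarrow> N \<le> i \<Longrightarrow> C < A_matrix_factor s (1 / p + e) i"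
    using A_matrix_factor_uniform[of s p C] s p C by (metis less_le_trans zero_less_one)
  have p1: "1 / p < 1" using p by simp
  \<comment> \<open>\<open>D\<close> results from solving \<open>C powr p * (S - N) \<le> B powr p * S\<close> for the sum \<open>S\<close>.\<close>
  define D where "D = C powr p * real N / (C powr p - B powr p)"
  have bound: "1 / (s * (p * e)) \<le> D" if e: "0 < e" "e < d" "e < 1 - 1 / p" "e < 1 / p" for e
  proof -
    define S where "S = (\<Sum>n. (s + real n) powr (- (p * e) - 1))"
    have seq: "B \<ge> 0" "C powr p * (S - real N) \<le> B powr p * S"
      unfolding S_def
      using A_matrix_power_sequence_bound[OF s p _ _ _ le, of e C N] fac[of e] e C
      by (auto intro: less_imp_le)
    have "B powr p < C powr p" using C p seq(1) by (intro powr_less_mono2) auto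
    then have "S \<le> D" unfolding D_def using seq(2) by (simp add: field_simps)
    moreover have "1 / (s * (p * e)) \<le> s powr - (p * e) / (p * e)"
    proof -
      \<comment> \<open>The restriction \<open>e < 1 / p\<close> keeps \<open>s powr - (p * e)\<close> at least \<open>1 / s\<close>.\<close>
      have "p * e \<le> 1" using e p by (simp add: field_simps)
      then have "s powr - 1 \<le> s powr - (p * e)" using s by (intro powr_mono) auto
      then have "s powr - 1 / (p * e) \<le> s powr - (p * e) / (p * e)"
        using e p by (intro divide_right_mono) auto
      then show ?thesis using s by (simp add: powr_minus field_simps)
    qed
    moreover have "s powr - (p * e) / (p * e) \<le> S"
      unfolding S_def using s p e by (intro suminf_shifted_powr_ge) auto
    ultimately show ?thesis by simp
  qed
  have "eventually (\<lambda>e. 1 / (s * (p * e)) \<le> D) (at_right 0)"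
    unfolding eventually_at_right_field
    using bound d p p1 by (intro exI[of _ "min d (min (1 - 1 / p) (1 / p))"]) auto
  moreover have "filterlim (\<lambda>e. 1 / (s * (p * e))) at_top (at_right 0)"
  proof -
    have "filterlim (\<lambda>e::real. 1 / (s * p) * inverse e) at_top (at_right 0)"
      using s p
      by (intro filterlim_tendsto_pos_mult_at_top[OF tendsto_const] filterlim_inverse_at_top_right) auto
    then show ?thesis by (simp add: field_simps)
  qed
  then have "eventually (\<lambda>e. D < 1 / (s * (p * e))) (at_right 0)"
    by (simp add: filterlim_at_top_dense)
  ultimately have "eventually (\<lambda>e::real. False) (at_right 0)"
    by eventually_elim simp
  then show False by (simp add: trivial_limit_at_right_real)
qed

theorem theorem2p3:
  fixes s p :: real
  assumes "s \<ge> 1" and "1 < p"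
  shows "ell_opnorm p (A_matrix s :: nat \<Rightarrow> nat \<Rightarrow> 'a::{real_normed_field,banach})
    = ereal (p\<^sup>2 / (p - 1))"
proof (rule antisym)
  show "ell_opnorm p (A_matrix s :: nat \<Rightarrow> nat \<Rightarrow> 'a) \<le> ereal (p\<^sup>2 / (p - 1))"
    using assms by (rule ell_opnorm_A_matrix_le)
  show "ereal (p\<^sup>2 / (p - 1)) \<le> ell_opnorm p (A_matrix s :: nat \<Rightarrow> nat \<Rightarrow> 'a)"
  proof (rule ccontr)
    assume "\<not> ?thesis"
    then have "ell_opnorm p (A_matrix s :: nat \<Rightarrow> nat \<Rightarrow> 'a) < ereal (p\<^sup>2 / (p - 1))" by simp
    then obtain B where "ell_opnorm p (A_matrix s :: nat \<Rightarrow> nat \<Rightarrow> 'a) < ereal B"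
      "ereal B < ereal (p\<^sup>2 / (p - 1))"
      using ereal_dense2 by blast
    then show False using ell_opnorm_A_matrix_not_le[OF assms, of B] by (auto intro: less_imp_le)
  qed
qed

end
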